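(* Let $f,g\in\mathcal{S}(\Omega)$ and fix $x\in\Omega$. If $x\in\Omega\cap\mathbb{R}$, then $(f\cdot g)(x)=f(x)g(x)$. Suppose instead $x\in\Omega\setminus\mathbb{R}$. If $y,z\in\mathbb{S}_x$ fulfill one of the following (mutually equivalent) conditions: 1. $yf(y)-f(y)z=0$; 2. $zf^c(z)-f^c(z)y=0$; then $$(f\cdot g)(y)=f(y)g(z).$$ Condition 1 is equivalent to $z=\mathscr{C}(f(y),y)$ when $f(y)$ is invertible; it is equivalent to $z\in T_{\mathscr{C}(f(y),y_1)}$ when $f(y)$ is a zero divisor; it is automatically fulfilled when $f(y)=0$. Similarly, condition 2 is equivalent to $y=\mathscr{C}(f^c(z),z)$ when $f^c(z)$ is invertible; it is equivalent to $y\in T_{\mathscr{C}(f^c(z),z_1)}$ when $f^c(z)$ is a zero divisor; it is automatically fulfilled when $f^c(z)=0$.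
   Context: $\mathbb{H}$ is the algebra of quaternions, with conjugation $q\mapsto q^c$; $\mathrm{Im}(\mathbb{H})$ is the space of purely imaginary quaternions; $p\perp q$ means $pq^c+qp^c=0$; $\mathbb{H}^*=\mathbb{H}\setminus\{0\}$. The dual quaternions are $\mathbb{DH}=\mathbb{H}+\epsilon\mathbb{H}$, with elements $h=h_1+\epsilon h_2$, componentwise addition and product $hh'=h_1h'_1+\epsilon(h_1h'_2+h_2h'_1)$; $h_1$ is the primal part of $h$ (a subscript $1$ denotes the primal part). The zero divisors of $\mathbb{DH}$ are the elements of $\epsilon\mathbb{H}^*$ (zero is not counted as a zero divisor). Put $h^c=h_1^c+\epsilon h_2^c$, $t(h)=h+h^c$, $n(h)=hh^c$. Let $\mathbb{S}_{\mathbb{DH}}=\{J\in\mathbb{DH}: t(J)=0,\ n(J)=1\}$, $Q_{\mathbb{DH}}=\{\alpha+\beta J:\alpha,\beta\in\mathbb{R},\ J\in\mathbb{S}_{\mathbb{DH}}\}$. For $x=\alpha+\beta J\in Q_{\mathbb{DH}}$ put $\mathbb{S}_x=\alpha+\beta\,\mathbb{S}_{\mathbb{DH}}$ and, if $x\notin\mathbb{R}$, $T_{x_1}=\{x_1+\epsilon\gamma:\gamma\in\mathrm{Im}(\mathbb{H}),\ \gamma\perp\mathrm{Im}(x_1)\}\subset\mathbb{S}_x$. For $h,l\in\mathbb{DH}$, $\mathscr{C}(h,l)$ is defined as $h^{-1}lh$ if $h$ is invertible (i.e. $h_1\ne0$), $h_2^{-1}lh_2$ if $h=\epsilon h_2\in\epsilon\mathbb{H}^*$,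 and $l$ if $h=0$. Let $D\subseteq\mathbb{C}$ be invariant under complex conjugation and $\Omega=\Omega_D=\{\alpha+\beta J:\alpha,\beta\in\mathbb{R},\ \alpha+i\beta\in D,\ J\in\mathbb{S}_{\mathbb{DH}}\}$. Let $\mathbb{DH}_{\mathbb{C}}=\mathbb{DH}\otimes_{\mathbb{R}}\mathbb{C}=\{a+\iota b: a,b\in\mathbb{DH}\}$, with $\iota^2=-1$, $\iota$ central, and $(a+\iota b)^c=a^c+\iota b^c$. A stem function is $F=F_1+\iota F_2:D\to\mathbb{DH}_{\mathbb{C}}$ with $F_1(\bar z)=F_1(z)$, $F_2(\bar z)=-F_2(z)$; it induces the slice function $f=\mathcal{I}(F):\Omega\to\mathbb{DH}$, $f(\alpha+\beta J)=F_1(\alpha+i\beta)+JF_2(\alpha+i\beta)$. $\mathcal{S}(\Omega)$ is the set of slice functions on $\Omega$. For $f=\mathcal{I}(F)$, $g=\mathcal{I}(G)$, put $f\cdot g=\mathcal{I}(FG)$ (pointwise product of stem functions) and $f^c=\mathcal{I}(F^c)$ with $F^c(z)=F(z)^c$. *)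

theory Defs
  imports Complex_Main "HOL-Library.FuncSet"
begin

codatatype quat = Quat (qre: real) (qi: real) (qj: real) (qk: real)

lemma quat_eq_iff:
  "p = q \<longleftrightarrow> qre p = qre q \<and> qi p = qi q \<and> qj p = qj q \<and> qk p = qk q"
  by (auto intro: quat.expand)

instantiation quat :: real_div_algebra
begin

primcorec zero_quat where
  "qre 0 = 0" | "qi 0 = 0" | "qj 0 = 0" | "qk 0 = 0"

primcorec one_quat where
  "qre 1 = 1" | "qi 1 = 0" | "qj 1 = 0" | "qk 1 = 0"

primcorec plus_quat where
  "qre (p + q) = qre p + qre q"
| "qi (p + q) = qi p + qi q"
| "qj (p + q) = qj p + qj q"
| "qk (p + q) = qk p + qk q"

primcorec uminus_quat where
  "qre (- p) = - qre p" | "qi (- p) = - qi p" | "qj (- p) = - qj p" | "qk (- p) = - qk p"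

primcorec minus_quat where
  "qre (p - q) = qre p - qre q"
| "qi (p - q) = qi p - qi q"
| "qj (p - q) = qj p - qj q"
| "qk (p - q) = qk p - qk q"

primcorec scaleR_quat where
  "qre (r *\<^sub>R p) = r * qre p"
| "qi (r *\<^sub>R p) = r * qi p"
| "qj (r *\<^sub>R p) = r * qj p"
| "qk (r *\<^sub>R p) = r * qk p"

primcorec times_quat where
  "qre (p * q) = qre p * qre q - qi p * qi q - qj p * qj q - qk p * qk q"
| "qi (p * q) = qre p * qi q + qi p * qre q + qj p * qk q - qk p * qj q"
| "qj (p * q) = qre p * qj q - qi p * qk q + qj p * qre q + qk p * qi q"
| "qk (p * q) = qre p * qk q + qi p * qj q - qj p * qi q + qk p * qre q"

primcorec inverse_quat where
  "qre (inverse p) = qre p / ((qre p)\<^sup>2 + (qi p)\<^sup>2 + (qj p)\<^sup>2 + (qk p)\<^sup>2)"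
| "qi (inverse p) = - qi p / ((qre p)\<^sup>2 + (qi p)\<^sup>2 + (qj p)\<^sup>2 + (qk p)\<^sup>2)"
| "qj (inverse p) = - qj p / ((qre p)\<^sup>2 + (qi p)\<^sup>2 + (qj p)\<^sup>2 + (qk p)\<^sup>2)"
| "qk (inverse p) = - qk p / ((qre p)\<^sup>2 + (qi p)\<^sup>2 + (qj p)\<^sup>2 + (qk p)\<^sup>2)"

definition "divide_quat (p::quat) q = p * inverse q"

lemma quat_norm_nz:
  assumes "p \<noteq> (0::quat)"
  shows "(qre p)\<^sup>2 + (qi p)\<^sup>2 + (qj p)\<^sup>2 + (qk p)\<^sup>2 \<noteq> 0"
proof
  assume a: "(qre p)\<^sup>2 + (qi p)\<^sup>2 + (qj p)\<^sup>2 + (qk p)\<^sup>2 = 0"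
  have "0 \<le> (qre p)\<^sup>2" "0 \<le> (qi p)\<^sup>2" "0 \<le> (qj p)\<^sup>2" "0 \<le> (qk p)\<^sup>2"
    by simp_all
  with a have "(qre p)\<^sup>2 = 0" "(qi p)\<^sup>2 = 0" "(qj p)\<^sup>2 = 0" "(qk p)\<^sup>2 = 0"
    by linarith+
  with assms show False by (simp add: quat_eq_iff)
qed

instance
proof
  fix p :: quat
  assume nz: "p \<noteq> 0"
  define N where "N = (qre p)\<^sup>2 + (qi p)\<^sup>2 + (qj p)\<^sup>2 + (qk p)\<^sup>2"
  have N: "N \<noteq> 0" using quat_norm_nz[OF nz] by (simp add: N_def)
  have *: "qre p * qre p / N + qi p * qi p / N + qj p * qj p / N + qk p * qk p / N = 1"
    using N by (simp add: add_divide_distrib[symmetric]) (simp add: N_def power2_eq_square)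
  show "inverse p * p = 1" "p * inverse p = 1"
    using * unfolding N_def by (auto simp: quat_eq_iff algebra_simps)
qed (auto simp: quat_eq_iff algebra_simps divide_quat_def)

end

primcorec qcnj :: "quat \<Rightarrow> quat" where
  "qre (qcnj q) = qre q"
| "qi (qcnj q) = - qi q"
| "qj (qcnj q) = - qj q"
| "qk (qcnj q) = - qk q"

definition qIm :: "quat \<Rightarrow> quat"
  where "qIm q = q - of_real (qre q)"

definition Im_quat :: "quat set"
  where "Im_quat = {q. qre q = 0}"

definition qorth :: "quat \<Rightarrow> quat \<Rightarrow> bool"  (infix "\<bottom>\<^sub>q" 50)
  where "p \<bottom>\<^sub>q q \<longleftrightarrow> p * qcnj q + q * qcnj p = 0"

text \<open>\<open>DQuat p q\<close> is $p + \epsilon q$.\<close>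

codatatype dquat = DQuat (primal: quat) (dual: quat)

lemma dquat_eq_iff: "h = k \<longleftrightarrow> primal h = primal k \<and> dual h = dual k"
  by (auto intro: dquat.expand)

instantiation dquat :: real_algebra_1
begin

primcorec zero_dquat where "primal 0 = 0" | "dual 0 = 0"

primcorec one_dquat where "primal 1 = 1" | "dual 1 = 0"

primcorec plus_dquat where
  "primal (h + k) = primal h + primal k" | "dual (h + k) = dual h + dual k"

primcorec uminus_dquat where "primal (- h) = - primal h" | "dual (- h) = - dual h"

primcorec minus_dquat where
  "primal (h - k) = primal h - primal k" | "dual (h - k) = dual h - dual k"

primcorec scaleR_dquat where
  "primal (r *\<^sub>R h) = r *\<^sub>R primal h" | "dual (r *\<^sub>R h) = r *\<^sub>R dual h"

primcorec times_dquat where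
  "primal (h * k) = primal h * primal k"
| "dual (h * k) = primal h * dual k + dual h * primal k"

instance
  by standard (auto simp: dquat_eq_iff algebra_simps)

end

definition of_quat :: "quat \<Rightarrow> dquat"
  where "of_quat q = DQuat q 0"

definition eps :: dquat  ("\<epsilon>")
  where "\<epsilon> = DQuat 0 1"

lemma dquat_decomp: "h = of_quat (primal h) + \<epsilon> * of_quat (dual h)"
  by (simp add: dquat_eq_iff of_quat_def eps_def)

lemma of_quat_of_real: "of_quat (of_real r) = of_real r"
  by (simp add: dquat_eq_iff of_quat_def of_real_def)

definition dcnj :: "dquat \<Rightarrow> dquat"
  where "dcnj h = DQuat (qcnj (primal h)) (qcnj (dual h))"

definition dtrace :: "dquat \<Rightarrow> dquat"
  where "dtrace h = h + dcnj h"

definition dnorm :: "dquat \<Rightarrow> dquat"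
  where "dnorm h = h * dcnj h"

definition dinvertible :: "dquat \<Rightarrow> bool"
  where "dinvertible h \<longleftrightarrow> (\<exists>k. h * k = 1 \<and> k * h = 1)"

definition dzero_divisor :: "dquat \<Rightarrow> bool"
  where "dzero_divisor h \<longleftrightarrow> h \<noteq> 0 \<and> (\<exists>k. k \<noteq> 0 \<and> (h * k = 0 \<or> k * h = 0))"

text \<open>\<open>dinv\<close> is the two-sided inverse for \<open>primal h \<noteq> 0\<close>; the value is irrelevant otherwise.\<close>

definition dinv :: "dquat \<Rightarrow> dquat"
  where "dinv h = DQuat (inverse (primal h)) (- (inverse (primal h) * dual h * inverse (primal h)))"

lemma dinv:
  assumes "primal h \<noteq> 0"
  shows "h * dinv h = 1" "dinv h * h = 1"
proof -
  have "primal h * (inverse (primal h) * q) = q" for q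
    using assms by (metis mult.assoc mult_1 right_inverse)
  with assms show "h * dinv h = 1" "dinv h * h = 1"
    by (auto simp: dquat_eq_iff dinv_def mult.assoc)
qed

lemma dinvertible_iff: "dinvertible h \<longleftrightarrow> primal h \<noteq> 0"
proof
  assume "dinvertible h"
  then obtain k where "h * k = 1" by (auto simp: dinvertible_def)
  hence "primal h * primal k = 1" by (simp add: dquat_eq_iff)
  thus "primal h \<noteq> 0" by auto
qed (use dinv in \<open>auto simp: dinvertible_def\<close>)

lemma dzero_divisor_iff: "dzero_divisor h \<longleftrightarrow> (\<exists>q. q \<noteq> 0 \<and> h = \<epsilon> * of_quat q)"
proof
  assume h: "dzero_divisor h"
  have "primal h = 0"
  proof (rule ccontr)
    assume p: "primal h \<noteq> 0"
    from h obtain k where k: "k \<noteq> 0" "h * k = 0 \<or> k * h = 0" by (auto simp: dzero_divisor_def)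
    from k(2) have "k = 0"
    proof
      assume "h * k = 0"
      with dinv(2)[OF p] show "k = 0" by (metis mult.assoc mult_1 mult_zero_right)
    next
      assume "k * h = 0"
      with dinv(1)[OF p] show "k = 0" by (metis mult.assoc mult.right_neutral mult_zero_left)
    qed
    with k(1) show False by simp
  qed
  with h show "\<exists>q. q \<noteq> 0 \<and> h = \<epsilon> * of_quat q"
    by (intro exI[of _ "dual h"]) (auto simp: dzero_divisor_def dquat_eq_iff of_quat_def eps_def)
next
  assume "\<exists>q. q \<noteq> 0 \<and> h = \<epsilon> * of_quat q"
  hence "h \<noteq> 0" "h * \<epsilon> = 0" "\<epsilon> \<noteq> 0"
    by (auto simp: dquat_eq_iff of_quat_def eps_def)
  thus "dzero_divisor h" by (auto simp: dzero_divisor_def)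
qed

definition dconj_by :: "dquat \<Rightarrow> dquat \<Rightarrow> dquat"  ("\<C>")
  where "\<C> h l =
    (if dinvertible h then dinv h * l * h
     else if h \<noteq> 0 then of_quat (inverse (dual h)) * l * of_quat (dual h)
     else l)"

definition SDH :: "dquat set"
  where "SDH = {J. dtrace J = 0 \<and> dnorm J = 1}"

text \<open>The set $\alpha + \beta\,\mathbb{S}$ for $x = \alpha + \beta J$. Different representations of
  \<open>x\<close> give the same set, so it does not matter that all of them are admitted.\<close>

definition dsphere :: "dquat \<Rightarrow> dquat set"
  where "dsphere x = {of_real \<alpha> + \<beta> *\<^sub>R K | \<alpha> \<beta> K.
    K \<in> SDH \<and> (\<exists>J\<in>SDH. x = of_real \<alpha> + \<beta> *\<^sub>R J)}"

text \<open>The index of \<open>T\<close> is a (non-real) quaternion, namely the primal part of a point of the cone.\<close>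

definition Tplane :: "quat \<Rightarrow> dquat set"
  where "Tplane p = {of_quat p + \<epsilon> * of_quat \<gamma> | \<gamma>. \<gamma> \<in> Im_quat \<and> \<gamma> \<bottom>\<^sub>q qIm p}"

lemma dconj_by_zero_divisor_of_quat:
  "dzero_divisor h \<Longrightarrow> \<C> h (of_quat p) = of_quat (inverse (dual h) * p * dual h)"
  by (auto simp: dconj_by_def dzero_divisor_iff dinvertible_iff dquat_eq_iff of_quat_def eps_def)

text \<open>\<open>CDQuat a b\<close> is $a + \iota b$ with $\iota$ central and $\iota^2 = -1$.\<close>

codatatype cdquat = CDQuat (cpart1: dquat) (cpart2: dquat)

lemma cdquat_eq_iff: "v = w \<longleftrightarrow> cpart1 v = cpart1 w \<and> cpart2 v = cpart2 w"
  by (auto intro: cdquat.expand)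

instantiation cdquat :: real_algebra_1
begin

primcorec zero_cdquat where "cpart1 0 = 0" | "cpart2 0 = 0"

primcorec one_cdquat where "cpart1 1 = 1" | "cpart2 1 = 0"

primcorec plus_cdquat where
  "cpart1 (v + w) = cpart1 v + cpart1 w" | "cpart2 (v + w) = cpart2 v + cpart2 w"

primcorec uminus_cdquat where "cpart1 (- v) = - cpart1 v" | "cpart2 (- v) = - cpart2 v"

primcorec minus_cdquat where
  "cpart1 (v - w) = cpart1 v - cpart1 w" | "cpart2 (v - w) = cpart2 v - cpart2 w"

primcorec scaleR_cdquat where
  "cpart1 (r *\<^sub>R v) = r *\<^sub>R cpart1 v" | "cpart2 (r *\<^sub>R v) = r *\<^sub>R cpart2 v"

primcorec times_cdquat where
  "cpart1 (v * w) = cpart1 v * cpart1 w - cpart2 v * cpart2 w"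
| "cpart2 (v * w) = cpart1 v * cpart2 w + cpart2 v * cpart1 w"

instance
  by standard (auto simp: cdquat_eq_iff algebra_simps)

end

text \<open>This conjugation leaves $\iota$ fixed.\<close>

definition cdcnj :: "cdquat \<Rightarrow> cdquat"
  where "cdcnj w = CDQuat (dcnj (cpart1 w)) (dcnj (cpart2 w))"

text \<open>Functions with domain \<open>D\<close> or \<open>Omega D\<close> are represented as extensional functions,
  i.e. they are \<open>undefined\<close> outside their domain. This makes \<open>slice_of D\<close> injective
  on the stem functions on \<open>D\<close> (see \<open>inj_on_slice_of\<close>).\<close>

definition Omega :: "complex set \<Rightarrow> dquat set"
  where "Omega D = {of_real \<alpha> + \<beta> *\<^sub>R J | \<alpha> \<beta> J. Complex \<alpha> \<beta> \<in> D \<and> J \<in> SDH}"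

definition stem_functions :: "complex set \<Rightarrow> (complex \<Rightarrow> cdquat) set"
  where "stem_functions D = {F \<in> extensional D. \<forall>z\<in>D.
    cpart1 (F (cnj z)) = cpart1 (F z) \<and> cpart2 (F (cnj z)) = - cpart2 (F z)}"

definition slice_of :: "complex set \<Rightarrow> (complex \<Rightarrow> cdquat) \<Rightarrow> dquat \<Rightarrow> dquat"
  where "slice_of D F = (\<lambda>x\<in>Omega D. THE v. \<exists>\<alpha> \<beta> J. Complex \<alpha> \<beta> \<in> D \<and> J \<in> SDH \<and>
    x = of_real \<alpha> + \<beta> *\<^sub>R J \<and> v = cpart1 (F (Complex \<alpha> \<beta>)) + J * cpart2 (F (Complex \<alpha> \<beta>)))"

definition slice_functions :: "complex set \<Rightarrow> (dquat \<Rightarrow> dquat) set"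
  where "slice_functions D = slice_of D ` stem_functions D"

definition stem_of :: "complex set \<Rightarrow> (dquat \<Rightarrow> dquat) \<Rightarrow> complex \<Rightarrow> cdquat"
  where "stem_of D = inv_into (stem_functions D) (slice_of D)"

definition slice_prod :: "complex set \<Rightarrow> (dquat \<Rightarrow> dquat) \<Rightarrow> (dquat \<Rightarrow> dquat) \<Rightarrow> dquat \<Rightarrow> dquat"
  where "slice_prod D f g = slice_of D (\<lambda>z\<in>D. stem_of D f z * stem_of D g z)"

definition slice_cnj :: "complex set \<Rightarrow> (dquat \<Rightarrow> dquat) \<Rightarrow> dquat \<Rightarrow> dquat"
  where "slice_cnj D f = slice_of D (\<lambda>z\<in>D. cdcnj (stem_of D f z))"

lemma SDH_square: "J \<in> SDH \<Longrightarrow> J * J = -1"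
proof -
  assume J: "J \<in> SDH"
  hence "dcnj J = - J" by (simp add: SDH_def dtrace_def eq_neg_iff_add_eq_0 add.commute)
  with J have "- (J * J) = 1" by (simp add: SDH_def dnorm_def)
  thus ?thesis by (metis add.inverse_inverse)
qed

lemma SDH_primal_re: "J \<in> SDH \<Longrightarrow> qre (primal J) = 0"
  by (simp add: SDH_def dtrace_def dcnj_def dquat_eq_iff quat_eq_iff)

lemma SDH_uminus: "J \<in> SDH \<Longrightarrow> - J \<in> SDH"
proof -
  assume J: "J \<in> SDH"
  have c: "dcnj (- J) = - dcnj J" by (simp add: dcnj_def dquat_eq_iff quat_eq_iff)
  have "dtrace (- J) = - dtrace J" by (simp add: dtrace_def c)
  moreover have "dnorm (- J) = dnorm J" by (simp add: dnorm_def c)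
  ultimately show "- J \<in> SDH" using J by (simp add: SDH_def)
qed

lemma SDH_nonempty: "\<exists>J. J \<in> SDH"
  by (rule exI[of _ "of_quat (Quat 0 1 0 0)"])
    (simp add: of_quat_def SDH_def dtrace_def dnorm_def dcnj_def dquat_eq_iff quat_eq_iff)

lemma cone_representation:
  assumes J: "J \<in> SDH" "K \<in> SDH"
    and eq: "of_real \<alpha> + \<beta> *\<^sub>R J = of_real \<alpha>' + \<beta>' *\<^sub>R (K::dquat)"
  shows "\<alpha>' = \<alpha> \<and> (\<beta>' = \<beta> \<and> (\<beta> = 0 \<or> K = J) \<or> \<beta>' = - \<beta> \<and> K = - J)"
proof -
  have "qre (primal (of_real \<alpha> + \<beta> *\<^sub>R J)) = qre (primal (of_real \<alpha>' + \<beta>' *\<^sub>R K))"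
    using eq by simp
  hence a: "\<alpha>' = \<alpha>" using J by (simp add: of_real_def SDH_primal_re)
  with eq have b: "\<beta> *\<^sub>R J = \<beta>' *\<^sub>R K" by simp
  hence "(\<beta> *\<^sub>R J) * (\<beta> *\<^sub>R J) = (\<beta>' *\<^sub>R K) * (\<beta>' *\<^sub>R K)" by simp
  hence "(\<beta> * \<beta>) *\<^sub>R (1::dquat) = (\<beta>' * \<beta>') *\<^sub>R 1" using J by (simp add: SDH_square)
  hence "\<beta> * \<beta> = \<beta>' * \<beta>'" by (metis scaleR_cancel_right zero_neq_one)
  hence "\<beta>' = \<beta> \<or> \<beta>' = - \<beta>" by (metis square_eq_iff)
  with a b show ?thesis
    by (cases "\<beta> = 0") (auto simp: scaleR_minus_left scaleR_minus_right[symmetric] simp del: scaleR_minus_right)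
qed

lemma slice_of_eq:
  assumes F: "F \<in> stem_functions D" and z: "Complex \<alpha> \<beta> \<in> D" and J: "J \<in> SDH"
  shows "slice_of D F (of_real \<alpha> + \<beta> *\<^sub>R J) =
    cpart1 (F (Complex \<alpha> \<beta>)) + J * cpart2 (F (Complex \<alpha> \<beta>))"
proof -
  let ?x = "of_real \<alpha> + \<beta> *\<^sub>R J"
  have x: "?x \<in> Omega D" using z J by (auto simp: Omega_def)
  have real: "cpart2 (F (Complex \<alpha> 0)) = 0" if "Complex \<alpha> 0 \<in> D"
  proof -
    have "cnj (Complex \<alpha> 0) = Complex \<alpha> 0" by (simp add: complex_eq_iff)
    with F that have "cpart2 (F (Complex \<alpha> 0)) = - cpart2 (F (Complex \<alpha> 0))"
      unfolding stem_functions_def by (metis (mono_tags, lifting) mem_Collect_eq)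
    hence "2 *\<^sub>R cpart2 (F (Complex \<alpha> 0)) = 0" by (simp add: scaleR_2 eq_neg_iff_add_eq_0)
    thus ?thesis by simp
  qed
  have odd: "cpart1 (F (Complex \<alpha> (- \<beta>))) = cpart1 (F (Complex \<alpha> \<beta>))"
    "cpart2 (F (Complex \<alpha> (- \<beta>))) = - cpart2 (F (Complex \<alpha> \<beta>))"
  proof -
    have "cnj (Complex \<alpha> \<beta>) = Complex \<alpha> (- \<beta>)" by (simp add: complex_eq_iff)
    with F z show "cpart1 (F (Complex \<alpha> (- \<beta>))) = cpart1 (F (Complex \<alpha> \<beta>))"
      "cpart2 (F (Complex \<alpha> (- \<beta>))) = - cpart2 (F (Complex \<alpha> \<beta>))"
      unfolding stem_functions_def by (metis (mono_tags, lifting) mem_Collect_eq)+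
  qed
  have "(THE v. \<exists>\<alpha>' \<beta>' K. Complex \<alpha>' \<beta>' \<in> D \<and> K \<in> SDH \<and> ?x = of_real \<alpha>' + \<beta>' *\<^sub>R K \<and>
      v = cpart1 (F (Complex \<alpha>' \<beta>')) + K * cpart2 (F (Complex \<alpha>' \<beta>'))) =
    cpart1 (F (Complex \<alpha> \<beta>)) + J * cpart2 (F (Complex \<alpha> \<beta>))"
  proof (rule the_equality)
    fix v
    assume "\<exists>\<alpha>' \<beta>' K. Complex \<alpha>' \<beta>' \<in> D \<and> K \<in> SDH \<and> ?x = of_real \<alpha>' + \<beta>' *\<^sub>R K \<and>
      v = cpart1 (F (Complex \<alpha>' \<beta>')) + K * cpart2 (F (Complex \<alpha>' \<beta>'))"
    then obtain \<alpha>' \<beta>' K where *: "K \<in> SDH" "?x = of_real \<alpha>' + \<beta>' *\<^sub>R K"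
      "v = cpart1 (F (Complex \<alpha>' \<beta>')) + K * cpart2 (F (Complex \<alpha>' \<beta>'))" by blast
    from cone_representation[OF J *(1,2)] *(3) real odd z
    show "v = cpart1 (F (Complex \<alpha> \<beta>)) + J * cpart2 (F (Complex \<alpha> \<beta>))" by auto
  qed (use z J in blast)
  thus ?thesis using x by (simp add: slice_of_def)
qed

lemma inj_on_slice_of: "inj_on (slice_of D) (stem_functions D)"
proof (rule inj_onI)
  fix F G
  assume F: "F \<in> stem_functions D" and G: "G \<in> stem_functions D"
    and eq: "slice_of D F = slice_of D G"
  obtain J where J: "J \<in> SDH" using SDH_nonempty by blast
  have "F z = G z" if z: "z \<in> D" for z
  proof -
    obtain \<alpha> \<beta> where ab: "z = Complex \<alpha> \<beta>" by (cases z)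
    have e: "cpart1 (F z) + K * cpart2 (F z) = cpart1 (G z) + K * cpart2 (G z)"
      if K: "K \<in> SDH" for K
      using slice_of_eq[OF F _ K, of \<alpha> \<beta>] slice_of_eq[OF G _ K, of \<alpha> \<beta>] z eq ab by simp
    define A where "A = cpart1 (F z) - cpart1 (G z)"
    define B where "B = cpart2 (F z) - cpart2 (G z)"
    have p: "A + J * B = 0" using e[OF J] by (simp add: A_def B_def algebra_simps)
    have m: "A - J * B = 0" using e[OF SDH_uminus[OF J]] by (simp add: A_def B_def algebra_simps)
    have "2 *\<^sub>R A = (A + J * B) + (A - J * B)" by (simp add: scaleR_2)
    with p m have A: "A = 0" by simp
    with p have "J * (J * B) = 0" by simp
    hence "B = 0" by (simp add: mult.assoc[symmetric] SDH_square[OF J])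
    with A show "F z = G z" by (simp add: cdquat_eq_iff A_def B_def)
  qed
  thus "F = G" using F G by (auto simp: stem_functions_def intro: extensionalityI)
qed

lemma stem_of_slice_of: "F \<in> stem_functions D \<Longrightarrow> stem_of D (slice_of D F) = F"
  unfolding stem_of_def by (rule inv_into_f_f[OF inj_on_slice_of])

end

(* With y = alpha + beta J, z = alpha + beta K, f(y) = a + J b and g(z) = c + K d, both conditions
   amount to a K + J b K = J a - b; this is exactly the identity that turns
   f(y) g(z) = a c + J b c + (a K + J b K) d into a c - b d + J (a d + b c) = (f . g)(y). *)

theory Submission
  imports Defs
begin

lemma qcnj_mult: "qcnj (p * q) = qcnj q * qcnj p"
  by (simp add: quat_eq_iff algebra_simps)

lemma dcnj_mult: "dcnj (h * k) = dcnj k * dcnj h"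
  by (simp add: dcnj_def dquat_eq_iff qcnj_mult) (simp add: quat_eq_iff)

lemma dcnj_add: "dcnj (h + k) = dcnj h + dcnj k"
  by (simp add: dcnj_def dquat_eq_iff quat_eq_iff)

lemma dcnj_minus: "dcnj (- h) = - dcnj h"
  by (simp add: dcnj_def dquat_eq_iff quat_eq_iff)

lemma dcnj_dcnj [simp]: "dcnj (dcnj h) = h"
  by (simp add: dcnj_def dquat_eq_iff quat_eq_iff)

lemma dcnj_inject: "dcnj h = dcnj k \<longleftrightarrow> h = k"
  by (metis dcnj_dcnj)

lemma SDH_dcnj: "J \<in> SDH \<Longrightarrow> dcnj J = - J"
  by (simp add: SDH_def dtrace_def eq_neg_iff_add_eq_0 add.commute)

text \<open>Products of two even or of two odd components are even and mixed products are odd.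
  Closure of \<open>D\<close> under \<open>cnj\<close> ensures that the restricted function still
  takes the product value, and not \<open>undefined\<close>, at the conjugate point.\<close>

lemma stem_functions_mult:
  assumes D: "\<And>w. w \<in> D \<Longrightarrow> cnj w \<in> D"
    and "F \<in> stem_functions D" "G \<in> stem_functions D"
  shows "(\<lambda>z\<in>D. F z * G z) \<in> stem_functions D"
  using assms by (auto simp: stem_functions_def)

text \<open>\<open>cdcnj\<close> fixes the central imaginary unit and acts on each component by the
  additive map \<open>dcnj\<close>, so the parities in z survive.\<close>

lemma stem_functions_cdcnj:
  assumes D: "\<And>w. w \<in> D \<Longrightarrow> cnj w \<in> D" and "F \<in> stem_functions D"
  shows "(\<lambda>z\<in>D. cdcnj (F z)) \<in> stem_functions D"
  using assms by (auto simp: stem_functions_def cdcnj_def dcnj_minus)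

lemma stem_function_real:
  assumes "F \<in> stem_functions D" "Complex \<alpha> 0 \<in> D"
  shows "cpart2 (F (Complex \<alpha> 0)) = 0"
proof -
  have "cnj (Complex \<alpha> 0) = Complex \<alpha> 0"
    by (simp add: complex_eq_iff)
  with assms have "cpart2 (F (Complex \<alpha> 0)) = - cpart2 (F (Complex \<alpha> 0))"
    unfolding stem_functions_def by (metis (mono_tags, lifting) mem_Collect_eq)
  hence "2 *\<^sub>R cpart2 (F (Complex \<alpha> 0)) = 0"
    by (simp add: scaleR_2 eq_neg_iff_add_eq_0)
  thus ?thesis by simp
qed

text \<open>\<open>stem_of\<close> gives back \<open>F\<close> and \<open>G\<close>, so the value
  can be read off from the two components of the product \<open>v * w\<close>. The membership of the
  product in \<open>stem_functions D\<close> is what allows evaluation at any representation of the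
  point.\<close>

lemma slice_prod_eq:
  assumes D: "\<And>w. w \<in> D \<Longrightarrow> cnj w \<in> D"
    and F: "F \<in> stem_functions D" and G: "G \<in> stem_functions D"
    and "Complex \<alpha> \<beta> \<in> D" "J \<in> SDH"
  defines "v \<equiv> F (Complex \<alpha> \<beta>)" and "w \<equiv> G (Complex \<alpha> \<beta>)"
  shows "slice_prod D (slice_of D F) (slice_of D G) (of_real \<alpha> + \<beta> *\<^sub>R J) =
    cpart1 v * cpart1 w - cpart2 v * cpart2 w + J * (cpart1 v * cpart2 w + cpart2 v * cpart1 w)"
  using slice_of_eq[OF stem_functions_mult[OF D F G] assms(4,5)] assms
  by (simp add: slice_prod_def stem_of_slice_of)

lemma slice_cnj_eq:
  assumes D: "\<And>w. w \<in> D \<Longrightarrow> cnj w \<in> D"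
    and F: "F \<in> stem_functions D" and "Complex \<alpha> \<beta> \<in> D" "J \<in> SDH"
  defines "v \<equiv> F (Complex \<alpha> \<beta>)"
  shows "slice_cnj D (slice_of D F) (of_real \<alpha> + \<beta> *\<^sub>R J) = dcnj (cpart1 v) + J * dcnj (cpart2 v)"
  using slice_of_eq[OF stem_functions_cdcnj[OF D F] assms(3,4)] assms
  by (simp add: slice_cnj_def stem_of_slice_of cdcnj_def)

lemma cone_real_iff:
  assumes J: "J \<in> SDH"
  shows "of_real \<alpha> + \<beta> *\<^sub>R J \<in> \<real> \<longleftrightarrow> \<beta> = 0"
proof
  assume "of_real \<alpha> + \<beta> *\<^sub>R J \<in> \<real>"
  then obtain r where "of_real \<alpha> + \<beta> *\<^sub>R J = of_real r" by (rule Reals_cases)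
  \<comment> \<open>The real number is given a cone representation with coefficient 0, to be
    compared with the given one.\<close>
  hence "of_real \<alpha> + \<beta> *\<^sub>R J = of_real r + 0 *\<^sub>R J" by simp
  from cone_representation[OF J J this] show "\<beta> = 0" by auto
qed simp

text \<open>Two representations of a cone point differ at most by the sign of \<beta>, and replacing
  \<open>K\<close> by \<open>- K\<close> absorbs that sign. One fixed pair \<alpha>, \<beta> thus
  describes the whole sphere.\<close>

lemma dsphere_cone:
  assumes J: "J \<in> SDH"
  shows "dsphere (of_real \<alpha> + \<beta> *\<^sub>R J) = {of_real \<alpha> + \<beta> *\<^sub>R K | K. K \<in> SDH}"
proof
  show "dsphere (of_real \<alpha> + \<beta> *\<^sub>R J) \<subseteq> {of_real \<alpha> + \<beta> *\<^sub>R K | K. K \<in> SDH}"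
  proof
    fix y assume "y \<in> dsphere (of_real \<alpha> + \<beta> *\<^sub>R J)"
    then obtain \<alpha>' \<beta>' K L where y: "y = of_real \<alpha>' + \<beta>' *\<^sub>R K" and K: "K \<in> SDH" and L: "L \<in> SDH"
      and eq: "of_real \<alpha> + \<beta> *\<^sub>R J = of_real \<alpha>' + \<beta>' *\<^sub>R L"
      unfolding dsphere_def by blast
    from cone_representation[OF J L eq] have "\<alpha>' = \<alpha>" "\<beta>' = \<beta> \<or> \<beta>' = - \<beta>" by auto
    with y have "y = of_real \<alpha> + \<beta> *\<^sub>R K \<or> y = of_real \<alpha> + \<beta> *\<^sub>R (- K)" by auto
    thus "y \<in> {of_real \<alpha> + \<beta> *\<^sub>R K | K. K \<in> SDH}" using K SDH_uminus by blast
  qed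
qed (use J in \<open>auto simp: dsphere_def\<close>)

text \<open>The real part is central and cancels, and the common factor \<beta> can be divided out.
  This is where the point being non-real enters.\<close>

lemma cone_commutes_iff:
  assumes "\<beta> \<noteq> 0"
  shows "(of_real \<alpha> + \<beta> *\<^sub>R J) * h - h * (of_real \<alpha> + \<beta> *\<^sub>R K) = 0 \<longleftrightarrow> J * h = h * (K::dquat)"
proof -
  have "(of_real \<alpha> + \<beta> *\<^sub>R J) * h - h * (of_real \<alpha> + \<beta> *\<^sub>R K) = \<beta> *\<^sub>R (J * h - h * K)"
    by (simp add: of_real_def algebra_simps)
  with assms show ?thesis by simp
qed

text \<open>\<open>J * J = -1\<close> turns \<open>J * (J * b)\<close> into
  \<open>- b\<close>.\<close>

lemma left_intertwine_iff:
  assumes "J \<in> SDH"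
  shows "J * (a + J * b) = (a + J * b) * K \<longleftrightarrow> a * K + J * b * K = J * a - b"
proof -
  have "J * (a + J * b) = J * a - b"
    using SDH_square[OF assms] by (simp add: distrib_left flip: mult.assoc)
  thus ?thesis by (auto simp: distrib_right)
qed

text \<open>\<open>dcnj\<close> reverses products and sends \<open>J\<close> and \<open>K\<close> to
  their negatives, so conjugating the equation gives
  \<open>(a - b * K) * K = J * (a - b * K)\<close>. With \<open>K * K = -1\<close> the left side is
  \<open>a * K + b\<close>; moving \<open>b\<close> and \<open>J * b * K\<close> across yields the
  same normal form as in \<open>left_intertwine_iff\<close>.\<close>

lemma right_intertwine_iff:
  assumes J: "J \<in> SDH" and K: "K \<in> SDH"
  shows "K * (dcnj a + K * dcnj b) = (dcnj a + K * dcnj b) * J \<longleftrightarrow> a * K + J * b * K = J * a - b"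
proof -
  have "K * (dcnj a + K * dcnj b) = (dcnj a + K * dcnj b) * J \<longleftrightarrow>
      (a - b * K) * K = J * (a - b * K)"
    by (subst dcnj_inject[symmetric])
      (simp add: dcnj_mult dcnj_add SDH_dcnj[OF J] SDH_dcnj[OF K])
  also have "\<dots> \<longleftrightarrow> a * K + b = J * a - J * b * K"
    using SDH_square[OF K] by (simp add: algebra_simps)
  also have "\<dots> \<longleftrightarrow> a * K + J * b * K = J * a - b"
    by (auto simp: algebra_simps)
  finally show ?thesis .
qed

lemma dinvertible_intertwine_iff:
  assumes "dinvertible h"
  shows "y * h - h * z = 0 \<longleftrightarrow> z = \<C> h y"
proof -
  have h: "h * dinv h = 1" "dinv h * h = 1"
    using assms dinv by (auto simp: dinvertible_iff)
  have "y * h = h * z \<longleftrightarrow> z = dinv h * (y * h)"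
    by (metis h mult.assoc mult_1)
  with assms show ?thesis by (simp add: dconj_by_def mult.assoc)
qed

text \<open>For a cone point the conditions on \<gamma> in \<open>Tplane\<close> hold automatically:
  \<open>dtrace K = 0\<close> makes the dual part imaginary, and the dual component of
  \<open>dnorm K = 1\<close> is the orthogonality relation. Only the primal part remains to be
  compared.\<close>

lemma Tplane_cone_iff:
  assumes "K \<in> SDH"
  shows "of_real \<alpha> + \<beta> *\<^sub>R K \<in> Tplane p \<longleftrightarrow> primal (of_real \<alpha> + \<beta> *\<^sub>R K) = p"
proof
  assume "of_real \<alpha> + \<beta> *\<^sub>R K \<in> Tplane p"
  thus "primal (of_real \<alpha> + \<beta> *\<^sub>R K) = p"
    unfolding Tplane_def mem_Collect_eq by (elim exE conjE, simp only:) (simp add: of_quat_def eps_def)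
next
  let ?z = "of_real \<alpha> + \<beta> *\<^sub>R K"
  assume p: "primal ?z = p"
  have im: "qre (primal K) = 0" "qre (dual K) = 0"
    using assms by (auto simp: SDH_def dtrace_def dcnj_def dquat_eq_iff quat_eq_iff)
  have z: "dual ?z = \<beta> *\<^sub>R dual K" "qIm p = \<beta> *\<^sub>R primal K"
    using im by (auto simp: p[symmetric] qIm_def of_real_def quat_eq_iff)
  have orth: "dual K * qcnj (primal K) + primal K * qcnj (dual K) = 0"
    using assms by (simp add: SDH_def dnorm_def dcnj_def dquat_eq_iff add.commute)
  have "qcnj (\<beta> *\<^sub>R q) = \<beta> *\<^sub>R qcnj q" for q
    by (simp add: quat_eq_iff)
  \<comment> \<open>Both arguments are \<beta> times a component of \<open>K\<close>, so the
    relation for \<open>K\<close> is merely scaled by the square of \<beta>.\<close>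
  hence "dual ?z * qcnj (qIm p) + qIm p * qcnj (dual ?z) =
      (\<beta> * \<beta>) *\<^sub>R (dual K * qcnj (primal K) + primal K * qcnj (dual K))"
    unfolding z by (simp add: scaleR_add_right)
  hence "dual ?z \<bottom>\<^sub>q qIm p"
    by (simp only: qorth_def orth scaleR_zero_right)
  moreover have "dual ?z \<in> Im_quat"
    unfolding z by (simp add: Im_quat_def im)
  ultimately show "?z \<in> Tplane p"
    \<comment> \<open>The witness for \<gamma> is \<open>dual ?z\<close>.\<close>
    unfolding Tplane_def p[symmetric] using dquat_decomp[of ?z] by blast
qed

text \<open>Since \<open>h\<close> is \<epsilon> times a nonzero quaternion, the equation sees only
  the primal parts of \<open>y\<close> and \<open>z\<close>, and cancelling that quaternion
  determines \<open>primal z\<close>. By \<open>Tplane_cone_iff\<close> this is all that membership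
  of a cone point in the plane requires.\<close>

lemma dzero_divisor_intertwine_iff:
  assumes "dzero_divisor h" "K \<in> SDH" and z: "z = of_real \<alpha> + \<beta> *\<^sub>R K"
  shows "y * h - h * z = 0 \<longleftrightarrow> z \<in> Tplane (primal (\<C> h (of_quat (primal y))))"
proof -
  from assms(1) have h: "primal h = 0" "dual h \<noteq> 0"
    by (auto simp: dzero_divisor_iff of_quat_def eps_def)
  have "y * h - h * z = 0 \<longleftrightarrow> primal y * dual h = dual h * primal z"
    using h by (simp add: dquat_eq_iff)
  also have "\<dots> \<longleftrightarrow> primal z = inverse (dual h) * primal y * dual h"
    using h by (metis mult.assoc mult_1 left_inverse right_inverse)
  also have "inverse (dual h) * primal y * dual h = primal (\<C> h (of_quat (primal y)))"
    unfolding dconj_by_zero_divisor_of_quat[OF assms(1)] by (simp add: of_quat_def)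
  finally show ?thesis
    unfolding z using Tplane_cone_iff[OF assms(2)] by simp
qed

theorem theorem6p1:
  fixes D :: "complex set" and f g :: "dquat \<Rightarrow> dquat" and x :: dquat
  assumes D: "\<And>w. w \<in> D \<Longrightarrow> cnj w \<in> D"
    and f: "f \<in> slice_functions D"
    and g: "g \<in> slice_functions D"
    and x: "x \<in> Omega D"
  shows "(x \<in> \<real> \<longrightarrow> slice_prod D f g x = f x * g x) \<and>
    (x \<notin> \<real> \<longrightarrow> (\<forall>y\<in>dsphere x. \<forall>z\<in>dsphere x.
      let cond1 = (y * f y - f y * z = 0);
          fc = slice_cnj D f;
          cond2 = (z * fc z - fc z * y = 0)
      in (cond1 \<longleftrightarrow> cond2) \<and>
         (cond1 \<or> cond2 \<longrightarrow> slice_prod D f g y = f y * g z) \<and>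
         (dinvertible (f y) \<longrightarrow> (cond1 \<longleftrightarrow> z = \<C> (f y) y)) \<and>
         (dzero_divisor (f y) \<longrightarrow>
            (cond1 \<longleftrightarrow> z \<in> Tplane (primal (\<C> (f y) (of_quat (primal y)))))) \<and>
         (f y = 0 \<longrightarrow> cond1) \<and>
         (dinvertible (fc z) \<longrightarrow> (cond2 \<longleftrightarrow> y = \<C> (fc z) z)) \<and>
         (dzero_divisor (fc z) \<longrightarrow>
            (cond2 \<longleftrightarrow> y \<in> Tplane (primal (\<C> (fc z) (of_quat (primal z)))))) \<and>
         (fc z = 0 \<longrightarrow> cond2)))"
proof -
  obtain F where F: "F \<in> stem_functions D" and fF: "f = slice_of D F"
    using f by (auto simp: slice_functions_def)
  obtain G where G: "G \<in> stem_functions D" and gG: "g = slice_of D G"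
    using g by (auto simp: slice_functions_def)
  obtain \<alpha> \<beta> I where w: "Complex \<alpha> \<beta> \<in> D" and I: "I \<in> SDH" and xI: "x = of_real \<alpha> + \<beta> *\<^sub>R I"
    using x by (auto simp: Omega_def)
  \<comment> \<open>These four stem values serve for every point of the sphere of \<open>x\<close>;
    only the unit \<open>J\<close> or \<open>K\<close> changes from point to point.\<close>
  define a b c d where abcd: "a = cpart1 (F (Complex \<alpha> \<beta>))" "b = cpart2 (F (Complex \<alpha> \<beta>))"
    "c = cpart1 (G (Complex \<alpha> \<beta>))" "d = cpart2 (G (Complex \<alpha> \<beta>))"
  have fv: "f (of_real \<alpha> + \<beta> *\<^sub>R J) = a + J * b"
    and gv: "g (of_real \<alpha> + \<beta> *\<^sub>R J) = c + J * d"
    and pv: "slice_prod D f g (of_real \<alpha> + \<beta> *\<^sub>R J) = a * c - b * d + J * (a * d + b * c)"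
    and cv: "slice_cnj D f (of_real \<alpha> + \<beta> *\<^sub>R J) = dcnj a + J * dcnj b" if "J \<in> SDH" for J
    using slice_of_eq[OF F w that] slice_of_eq[OF G w that] slice_prod_eq[OF D F G w that]
      slice_cnj_eq[OF D F w that] by (simp_all add: fF gG abcd)
  show ?thesis
  proof (intro conjI impI ballI)
    assume "x \<in> \<real>"
    hence "\<beta> = 0" using cone_real_iff[OF I] by (simp add: xI)
    \<comment> \<open>The odd components vanish on the real axis, which leaves \<open>a * c\<close>
      on both sides.\<close>
    hence "b = 0" "d = 0" using stem_function_real F G w by (simp_all add: abcd)
    thus "slice_prod D f g x = f x * g x"
      unfolding xI using fv[OF I] gv[OF I] pv[OF I] by simp
  next
    fix y z
    assume "x \<notin> \<real>" and y: "y \<in> dsphere x" and z: "z \<in> dsphere x"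
    hence \<beta>: "\<beta> \<noteq> 0" using cone_real_iff[OF I] by (simp add: xI)
    obtain J where J: "J \<in> SDH" and yJ: "y = of_real \<alpha> + \<beta> *\<^sub>R J"
      using y dsphere_cone[OF I] by (auto simp: xI)
    obtain K where K: "K \<in> SDH" and zK: "z = of_real \<alpha> + \<beta> *\<^sub>R K"
      using z dsphere_cone[OF I] by (auto simp: xI)
    let ?fc = "slice_cnj D f"
    have c1: "y * f y - f y * z = 0 \<longleftrightarrow> a * K + J * b * K = J * a - b"
      using cone_commutes_iff[OF \<beta>] left_intertwine_iff[OF J] fv[OF J] by (simp add: yJ zK)
    have c2: "z * ?fc z - ?fc z * y = 0 \<longleftrightarrow> a * K + J * b * K = J * a - b"
      using cone_commutes_iff[OF \<beta>] right_intertwine_iff[OF J K] cv[OF K] by (simp add: yJ zK)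
    have prod: "slice_prod D f g y = f y * g z" if e: "a * K + J * b * K = J * a - b"
    proof -
      have "f y * g z = a * c + J * b * c + (a * K + J * b * K) * d"
        using fv[OF J] gv[OF K] by (simp add: yJ zK algebra_simps)
      also have "\<dots> = slice_prod D f g y"
        unfolding e using pv[OF J] by (simp add: yJ algebra_simps)
      finally show ?thesis by simp
    qed
    have zd1: "dzero_divisor (f y) \<Longrightarrow>
        y * f y - f y * z = 0 \<longleftrightarrow> z \<in> Tplane (primal (\<C> (f y) (of_quat (primal y))))"
      by (rule dzero_divisor_intertwine_iff[OF _ K zK])
    have zd2: "dzero_divisor (?fc z) \<Longrightarrow>
        z * ?fc z - ?fc z * y = 0 \<longleftrightarrow> y \<in> Tplane (primal (\<C> (?fc z) (of_quat (primal z))))"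
      by (rule dzero_divisor_intertwine_iff[OF _ J yJ])
    show "let cond1 = (y * f y - f y * z = 0);
          fc = slice_cnj D f;
          cond2 = (z * fc z - fc z * y = 0)
      in (cond1 \<longleftrightarrow> cond2) \<and>
         (cond1 \<or> cond2 \<longrightarrow> slice_prod D f g y = f y * g z) \<and>
         (dinvertible (f y) \<longrightarrow> (cond1 \<longleftrightarrow> z = \<C> (f y) y)) \<and>
         (dzero_divisor (f y) \<longrightarrow>
            (cond1 \<longleftrightarrow> z \<in> Tplane (primal (\<C> (f y) (of_quat (primal y)))))) \<and>
         (f y = 0 \<longrightarrow> cond1) \<and>
         (dinvertible (fc z) \<longrightarrow> (cond2 \<longleftrightarrow> y = \<C> (fc z) z)) \<and>
         (dzero_divisor (fc z) \<longrightarrow>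
            (cond2 \<longleftrightarrow> y \<in> Tplane (primal (\<C> (fc z) (of_quat (primal z)))))) \<and>
         (fc z = 0 \<longrightarrow> cond2)"
      unfolding Let_def
    proof (intro conjI impI)
      show "y * f y - f y * z = 0 \<longleftrightarrow> z * ?fc z - ?fc z * y = 0"
        by (simp only: c1 c2)
    next
      assume "y * f y - f y * z = 0 \<or> z * ?fc z - ?fc z * y = 0"
      thus "slice_prod D f g y = f y * g z"
        using prod c1 c2 by blast
    next
      assume "f y = 0"
      thus "y * f y - f y * z = 0" by simp
    next
      assume "?fc z = 0"
      thus "z * ?fc z - ?fc z * y = 0" by simp
    \<comment> \<open>What remains are the invertible and zero divisor cases of both conditions.
      Condition 2 is condition 1 with \<open>y\<close> and \<open>z\<close> exchanged and
      \<open>?fc z\<close> in place of \<open>f y\<close>, so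
      \<open>dinvertible_intertwine_iff\<close> covers both invertible cases.\<close>
    qed (fact dinvertible_intertwine_iff zd1 zd2)+
  qed
qed

end
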